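(* Let $\alpha,\theta>0$ and let $\{N(t),\,t\ge 0\}$ be a Bell-Touchard process with parameters $(\alpha,\theta)$. Then for all $t\ge 0$, $N(t)\sim BT(\alpha t,\theta)$, i.e. $$\Pr[N(t)=k]=e^{-\alpha t(e^{\theta}-1)}\frac{\theta^{k}}{k!}B_k(\alpha t),\qquad k\in\mathbb{N}_0 .$$
   Context: $\mathbb{N}=\{1,2,\dots\}$, $\mathbb{N}_0=\mathbb{N}\cup\{0\}$. For $n\in\mathbb{N}_0$ and $x\in\mathbb{R}$ the (single variable) Bell polynomial is $B_n(x)=e^{-x}\sum_{k=0}^{\infty}\frac{k^n}{k!}x^k$ (with $0^0=1$). A random variable $Y$ is Bell-Touchard, $Y\sim BT(\alpha,\theta)$, if $\Pr[Y=x]=e^{-\alpha(e^\theta-1)}\frac{\theta^x}{x!}B_x(\alpha)$ for $x\in\mathbb{N}_0$; $BT(0,\theta)$ is the point mass at $0$. A counting process $\{N(t),t\ge0\}$ is an $\mathbb{N}_0$-valued stochastic process where $N(t)$ is the number of events that have occurred up to time $t$ (so it is nondecreasing in $t$ and $N(t+s)-N(t)$ is the number of events in the intervening interval of length $s$). A function $f:\mathbb{R}\to\mathbb{R}$ is $o(s)$ if $\lim_{s\to0}f(s)/s=0$. A counting process is a Bell-Touchard process with parameters $(\alpha,\theta)$, $\alpha,\theta>0$, if (1) $N(0)=0$; (2) it has stationary and independent increments; (3) $\Pr[N(t+s)-N(t)=k]=\alpha s\,\theta^k/k!+o(s)$ for every $k\in\mathbb{N}$ and $s,t>0$. *)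

theory Defs
  imports "HOL-Probability.Probability"
begin

section \<open>Bell polynomials and the Bell-Touchard distribution\<close>

definition bell_poly :: "nat \<Rightarrow> real \<Rightarrow> real" where
  "bell_poly n x = exp (- x) * (\<Sum>k. real k ^ n / fact k * x ^ k)"

text \<open>The defining series converges for every real argument, so \<^const>\<open>suminf\<close> is
  never applied to a divergent series.\<close>

lemma summable_bell_poly: "summable (\<lambda>k. real k ^ n / fact k * x ^ k :: real)"
proof (rule summable_comparison_test')
  have "summable (\<lambda>k. inverse (fact k) * (exp 1 * \<bar>x\<bar>) ^ k)"
    by (rule summable_exp)
  then show "summable (\<lambda>k. fact n * (inverse (fact k) * (exp 1 * \<bar>x\<bar>) ^ k))"
    by (rule summable_mult)
next
  fix k :: nat
  have "real k ^ n / fact n \<le> (\<Sum>i\<le>n. real k ^ i / fact i)"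
    by (intro member_le_sum) auto
  also have "\<dots> = (\<Sum>i\<in>{..n}. inverse (fact i) * real k ^ i)"
    by (simp add: divide_inverse mult.commute)
  also have "\<dots> \<le> (\<Sum>i. inverse (fact i) * real k ^ i)"
    by (intro sum_le_suminf summable_exp) auto
  also have "\<dots> = exp (real k)"
    by (simp add: exp_def)
  finally have "real k ^ n \<le> fact n * exp 1 ^ k"
    by (simp add: field_simps exp_of_nat_mult [symmetric])
  then have "real k ^ n * (\<bar>x\<bar> ^ k / fact k) \<le> fact n * exp 1 ^ k * (\<bar>x\<bar> ^ k / fact k)"
    by (intro mult_right_mono) auto
  then show "norm (real k ^ n / fact k * x ^ k) \<le> fact n * (inverse (fact k) * (exp 1 * \<bar>x\<bar>) ^ k)"
    by (simp add: abs_mult power_abs power_mult_distrib field_simps)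
qed

definition bell_touchard_mass :: "real \<Rightarrow> real \<Rightarrow> nat \<Rightarrow> real" where
  "bell_touchard_mass \<alpha> \<theta> x =
     exp (- \<alpha> * (exp \<theta> - 1)) * (\<theta> ^ x / fact x) * bell_poly x \<alpha>"

text \<open>The formula also covers the degenerate case: \<open>BT(0, \<theta>)\<close> is the point mass at \<open>0\<close>.\<close>

lemma bell_poly_0_right: "bell_poly n 0 = (if n = 0 then 1 else 0)"
proof -
  have "(\<Sum>k. real k ^ n / fact k * 0 ^ k) = (\<Sum>k\<in>{0}. real k ^ n / fact k * 0 ^ k :: real)"
    by (rule suminf_finite) auto
  then show ?thesis
    by (simp add: bell_poly_def)
qed

lemma bell_touchard_mass_0: "bell_touchard_mass 0 \<theta> x = (if x = 0 then 1 else 0)"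
  by (simp add: bell_touchard_mass_def bell_poly_0_right)

definition (in prob_space) bell_touchard_distributed ::
    "('a \<Rightarrow> nat) \<Rightarrow> real \<Rightarrow> real \<Rightarrow> bool" where
  "bell_touchard_distributed Y \<alpha> \<theta> \<longleftrightarrow>
     random_variable (count_space UNIV) Y \<and>
     (\<forall>x. prob {\<omega> \<in> space M. Y \<omega> = x} = bell_touchard_mass \<alpha> \<theta> x)"

section \<open>Bell-Touchard processes\<close>

text \<open>Processes are indexed by \<^typ>\<open>real\<close>, but only their values at times \<open>t \<ge> 0\<close> matter.\<close>

definition (in prob_space) counting_process :: "(real \<Rightarrow> 'a \<Rightarrow> nat) \<Rightarrow> bool" where
  "counting_process N \<longleftrightarrow>
     (\<forall>t\<ge>0. random_variable (count_space UNIV) (N t)) \<and>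
     (\<forall>\<omega>\<in>space M. \<forall>s t. 0 \<le> s \<and> s \<le> t \<longrightarrow> N s \<omega> \<le> N t \<omega>)"

text \<open>The subtraction on \<^typ>\<open>nat\<close> below is not truncated for counting processes, since their
  paths are nondecreasing.\<close>

definition increment :: "(real \<Rightarrow> 'a \<Rightarrow> nat) \<Rightarrow> real \<Rightarrow> real \<Rightarrow> 'a \<Rightarrow> nat" where
  "increment N s t \<omega> = N t \<omega> - N s \<omega>"

definition (in prob_space) stationary_increments :: "(real \<Rightarrow> 'a \<Rightarrow> nat) \<Rightarrow> bool" where
  "stationary_increments N \<longleftrightarrow>
     (\<forall>t\<ge>0. \<forall>u\<ge>0. \<forall>s>0.
        distr M (count_space UNIV) (increment N t (t + s)) =
        distr M (count_space UNIV) (increment N u (u + s)))"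

definition (in prob_space) independent_increments :: "(real \<Rightarrow> 'a \<Rightarrow> nat) \<Rightarrow> bool" where
  "independent_increments N \<longleftrightarrow>
     (\<forall>n (\<tau> :: nat \<Rightarrow> real). 0 \<le> \<tau> 0 \<and> (\<forall>i<n. \<tau> i < \<tau> (Suc i)) \<longrightarrow>
        indep_vars (\<lambda>_. count_space UNIV) (\<lambda>i. increment N (\<tau> i) (\<tau> (Suc i))) {..<n})"

text \<open>The last clause says that the remainder
  \<open>Pr[N(t+s) - N(t) = k] - \<alpha> s \<theta>\<^sup>k / k!\<close> is \<open>o(s)\<close>, separately for each \<open>k \<ge> 1\<close> and each
  \<open>t > 0\<close>; the limit is one-sided because only \<open>s > 0\<close> is meaningful.\<close>

definition (in prob_space) bell_touchard_process ::
    "real \<Rightarrow> real \<Rightarrow> (real \<Rightarrow> 'a \<Rightarrow> nat) \<Rightarrow> bool" where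
  "bell_touchard_process \<alpha> \<theta> N \<longleftrightarrow>
     counting_process N \<and>
     (\<forall>\<omega>\<in>space M. N 0 \<omega> = 0) \<and>
     stationary_increments N \<and>
     independent_increments N \<and>
     (\<forall>k\<ge>1. \<forall>t>0.
        ((\<lambda>s. (prob {\<omega> \<in> space M. increment N t (t + s) \<omega> = k} - \<alpha> * s * \<theta> ^ k / fact k) / s)
           \<longlongrightarrow> 0) (at_right 0))"

end

theory Submission
  imports Defs "HOL-Complex_Analysis.Cauchy_Integral_Formula" "HOL-Real_Asymp.Real_Asymp"
begin

text \<open>
  The proof runs through the probability generating function \<open>G\<^sub>t(z) = E z^N(t)\<close> on \<open>0 \<le> z < 1\<close>.
  Cutting \<open>[0, t]\<close> into \<open>n\<close> equal pieces, stationarity and independence of the increments give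
  \<open>G\<^sub>t(z) = G\<^bsub>t/n\<^esub>(z)^n\<close> (\<open>pgf_power\<close>). Hence \<open>n (G\<^bsub>t/n\<^esub>(z) - 1)\<close>
  converges to \<open>ln G\<^sub>t(z)\<close>. On the other hand,
  \<open>n (G\<^bsub>t/n\<^esub>(z) - 1) = n (Pr[N(t/n) = 0] - 1) + (\<Sum>k\<ge>1. n Pr[N(t/n) = k] z^k)\<close>,
  and the infinitesimal condition says that the \<open>k\<close>-th rate \<open>n Pr[N(t/n) = k]\<close> tends to
  \<open>\<alpha> t \<theta>^k / k!\<close> (\<open>bell_touchard_process_rate\<close>).

  The difficulty is that the condition holds for each \<open>k \<ge> 1\<close> separately, without
  uniformity in \<open>k\<close>, and says nothing about \<open>k = 0\<close>; so it is not immediate that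
  \<open>Pr[N(s) = 0] = 1 - \<alpha> s (e^\<theta> - 1) + o(s)\<close>. Taking \<open>z = 0\<close> in the root relation
  resolves this: \<open>n (Pr[N(t/n) = 0] - 1)\<close> converges to the logarithm of
  \<open>p\<^sub>0 = Pr[N(t) = 0]\<close>, a positive number since otherwise each of the \<open>n\<close> increments would
  be at least \<open>1\<close> almost surely, for every \<open>n\<close>, although \<open>N(t)\<close> is finite. In particular the sequence is bounded, which bounds
  all rates at once and, for \<open>z < 1\<close>, allows the limit to be taken inside the
  series. The outcome (\<open>generating_function_of_nth_roots\<close>) is
  \<open>G\<^sub>t(z) = p\<^sub>0 exp (\<alpha> t (e^(\<theta> z) - 1))\<close> with \<open>p\<^sub>0\<close> still unknown.

  By Dobinski's formula the coefficients of \<open>exp (x (e^(\<theta> z) - 1))\<close> are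
  \<open>\<theta>^k / k! B\<^sub>k(x)\<close> (\<open>bell_poly_generating_function\<close>). Uniqueness of power
  series coefficients therefore yields \<open>Pr[N(t) = k] = p\<^sub>0 \<theta>^k / k! B\<^sub>k(\<alpha> t)\<close>, and
  since the left-hand sides sum to \<open>1\<close>, evaluating the Bell series at \<open>z = 1\<close>
  gives \<open>p\<^sub>0 = exp (- \<alpha> t (e^\<theta> - 1))\<close>.
\<close>

section \<open>Power series\<close>

text \<open>A power series with a nonzero coefficient of positive degree and value \<open>0\<close> at the
  origin has an isolated zero there, whereas the difference of the two series vanishes on
  \<open>[0, 1)\<close>.\<close>

lemma powser_coeffs_unique:
  fixes a b :: "nat \<Rightarrow> real"
  assumes a: "\<And>z. 0 \<le> z \<Longrightarrow> z < 1 \<Longrightarrow> (\<lambda>k. a k * z ^ k) sums f z"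
    and b: "\<And>z. 0 \<le> z \<Longrightarrow> z < 1 \<Longrightarrow> (\<lambda>k. b k * z ^ k) sums f z"
  shows "a = b"
proof (rule ccontr)
  assume "a \<noteq> b"
  define d where "d k = a k - b k" for k
  have d_sums: "(\<lambda>k. d k * z ^ k) sums 0" if "0 \<le> z" "z < 1" for z
    using sums_diff[OF a[OF that] b[OF that]] by (simp add: d_def left_diff_distrib)
  have "d 0 = 0"
    using d_sums[of 0] by simp
  moreover obtain m where "d m \<noteq> 0"
    using \<open>a \<noteq> b\<close> by (auto simp: d_def fun_eq_iff)
  ultimately have m: "m > 0" "d m \<noteq> 0"
    by (auto intro: gr0I)
  have ball: "(\<lambda>k. d k * (z - 0) ^ k) sums (\<Sum>k. d k * z ^ k)" if z: "norm (z - 0) < 1 / 2" for z :: real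
  proof -
    have "summable (\<lambda>k. d k * (1 / 2) ^ k)"
      using d_sums[of "1 / 2"] by (simp add: sums_iff)
    then have "summable (\<lambda>k. d k * z ^ k)"
      by (rule powser_inside) (use z in simp)
    then show ?thesis
      by (simp add: summable_sums)
  qed
  have "(\<Sum>k. d k * 0 ^ k) = 0"
    using d_sums[of 0] by (simp add: sums_iff)
  then obtain s where s: "0 < s" "\<And>z. z \<in> cball 0 s - {0} \<Longrightarrow> (\<Sum>k. d k * z ^ k) \<noteq> 0"
    using powser_0_nonzero[of "1 / 2" 0 d "\<lambda>z. \<Sum>k. d k * z ^ k" m] ball m by auto
  define z where "z = min s (1 / 2)"
  have "(\<Sum>k. d k * z ^ k) = 0"
    using d_sums[of z] s(1) by (simp add: sums_iff z_def)
  moreover have "z \<in> cball 0 s - {0}"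
    using s(1) by (auto simp: z_def)
  ultimately show False
    using s(2) by blast
qed

text \<open>Expand \<open>exp (x e^(\<theta> z)) = (\<Sum>j. x^j / j! e^(j \<theta> z))\<close> and then each
  \<open>e^(j \<theta> z)\<close> as a series in \<open>z\<close>. All terms of the double series are nonnegative, so it may
  be summed over \<open>j\<close> first, and the inner sum is the series defining \<open>B\<^sub>n(x)\<close>.\<close>

lemma bell_poly_generating_function:
  fixes x \<theta> z :: real
  assumes "x \<ge> 0" "\<theta> \<ge> 0" "z \<ge> 0"
  shows "(\<lambda>n. \<theta> ^ n / fact n * bell_poly n x * z ^ n) sums exp (x * (exp (\<theta> * z) - 1))"
proof -
  define f :: "nat \<times> nat \<Rightarrow> real"
    where "f = (\<lambda>(j, n). exp (- x) * (x ^ j / fact j) * ((real j * (\<theta> * z)) ^ n / fact n))"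
  define g where "g j = exp (- x) * (x ^ j / fact j) * exp (real j * (\<theta> * z))" for j
  have f_nonneg: "f q \<ge> 0" for q
    using assms by (auto simp: f_def split: prod.splits)
  have exp_has_sum: "((\<lambda>n. y ^ n / fact n) has_sum exp y) UNIV" if "y \<ge> 0" for y :: real
    using exp_converges[of y] that
    by (intro sums_nonneg_imp_has_sum) (auto simp: field_simps scaleR_conv_of_real)
  have row: "((\<lambda>n. f (j, n)) has_sum g j) UNIV" for j
    unfolding f_def g_def prod.case using assms
    by (intro has_sum_cmult_right exp_has_sum) auto
  have g_eq: "g j = exp (- x) * ((x * exp (\<theta> * z)) ^ j / fact j)" for j
    by (simp add: g_def power_mult_distrib exp_of_nat_mult)
  have g_sum: "(g has_sum exp (x * (exp (\<theta> * z) - 1))) UNIV"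
  proof -
    have "(g has_sum exp (- x) * exp (x * exp (\<theta> * z))) UNIV"
      unfolding g_eq using assms by (intro has_sum_cmult_right exp_has_sum) auto
    then show ?thesis
      by (simp add: exp_add [symmetric] algebra_simps)
  qed
  have "f summable_on UNIV \<times> UNIV"
    using row g_sum f_nonneg by (intro summable_on_SigmaI) (auto simp: summable_on_def)
  then obtain S where S: "(f has_sum S) (UNIV \<times> UNIV)"
    by (auto simp: summable_on_def)
  have "(g has_sum S) UNIV"
    using S row by (rule has_sum_SigmaD)
  with g_sum have S_eq: "S = exp (x * (exp (\<theta> * z) - 1))"
    using has_sum_unique by blast
  have column: "((\<lambda>j. f (j, n)) has_sum \<theta> ^ n / fact n * bell_poly n x * z ^ n) UNIV" for n
  proof -
    have "(\<lambda>j. real j ^ n / fact j * x ^ j) sums (\<Sum>j. real j ^ n / fact j * x ^ j)"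
      by (rule summable_sums [OF summable_bell_poly])
    from sums_mult [OF this, of "exp (- x) * (\<theta> * z) ^ n / fact n"]
    have "(\<lambda>j. f (j, n)) sums (\<theta> ^ n / fact n * bell_poly n x * z ^ n)"
      by (simp add: f_def bell_poly_def power_mult_distrib mult_ac)
    then show ?thesis
      using f_nonneg by (intro sums_nonneg_imp_has_sum) auto
  qed
  have "((\<lambda>(n, j). f (j, n)) has_sum S) (UNIV \<times> UNIV)"
    using S has_sum_swap by blast
  then have "((\<lambda>n. \<theta> ^ n / fact n * bell_poly n x * z ^ n) has_sum S) UNIV"
    by (rule has_sum_SigmaD) (use column in simp)
  then show ?thesis
    unfolding S_eq by (rule has_sum_imp_sums)
qed

section \<open>Generating functions with n-th roots\<close>

text \<open>The hypothesis means \<open>y n = c powr (1 / n)\<close>, so the limit is the derivative of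
  \<open>c powr u\<close> at \<open>u = 0\<close>.\<close>

lemma nth_roots_log_limit:
  fixes y :: "nat \<Rightarrow> real"
  assumes "\<And>n. n \<ge> 1 \<Longrightarrow> y n \<ge> 0" and root: "\<And>n. n \<ge> 1 \<Longrightarrow> y n ^ n = c" and "c > 0"
  shows "(\<lambda>n. real n * (y n - 1)) \<longlonglongrightarrow> ln c"
proof -
  have "(\<lambda>n. real n * (c powr (1 / real n) - 1)) \<longlonglongrightarrow> ln c"
    using \<open>c > 0\<close> by real_asymp
  moreover have "\<forall>\<^sub>F n in sequentially. real n * (c powr (1 / real n) - 1) = real n * (y n - 1)"
    using eventually_ge_at_top[of 1]
  proof eventually_elim
    case (elim n)
    then have "y n > 0"
      using assms(1)[OF elim] root[OF elim] \<open>c > 0\<close> by (cases "y n = 0") (auto simp: power_0_left)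
    then have "c powr (1 / real n) = y n"
      using elim by (simp add: root[OF elim, symmetric] powr_realpow [symmetric] powr_powr)
    then show ?case
      by simp
  qed
  ultimately show ?thesis
    by (rule Lim_transform_eventually)
qed

text \<open>
  Here \<open>p n\<close> is a probability distribution on the naturals with generating function \<open>G n\<close>, and
  \<open>p 1\<close> is its \<open>n\<close>-fold convolution power. The conclusion exhibits \<open>G 1\<close> as the generating
  function of a compound Poisson law with jump rates \<open>c\<close>, with \<open>p 1 0\<close> as normalising factor.
  The limit \<open>c\<close> is only assumed
  to exist pointwise: the domination \<open>n p n k \<le> n (1 - p n 0)\<close>, whose right-hand side
  converges, replaces uniformity in \<open>k\<close>.
\<close>

lemma generating_function_of_nth_roots:
  fixes p :: "nat \<Rightarrow> nat \<Rightarrow> real" and G :: "nat \<Rightarrow> real \<Rightarrow> real"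
  assumes nonneg: "\<And>n k. p n k \<ge> 0"
    and total: "\<And>n. p n sums 1"
    and G: "\<And>n z. 0 \<le> z \<Longrightarrow> z < 1 \<Longrightarrow> (\<lambda>k. p n k * z ^ k) sums G n z"
    and root: "\<And>n z. n \<ge> 1 \<Longrightarrow> 0 \<le> z \<Longrightarrow> z < 1 \<Longrightarrow> G n z ^ n = G 1 z"
    and rate: "\<And>k. k \<ge> 1 \<Longrightarrow> (\<lambda>n. real n * p n k) \<longlonglongrightarrow> c k"
    and z: "0 \<le> z" "z < 1"
  shows "G 1 z = p 1 0 * exp (\<Sum>k. c (Suc k) * z ^ Suc k)"
proof -
  have G_tail: "(\<lambda>k. p n (Suc k) * z ^ Suc k) sums (G n z - p n 0)" if "0 \<le> z" "z < 1" for n z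
    using G[OF that, of n] by (subst sums_Suc_iff) simp
  have p_tail: "(\<lambda>k. p n (Suc k)) sums (1 - p n 0)" for n
    using total[of n] by (subst sums_Suc_iff) simp
  have G_0: "G n 0 = p n 0" for n
    using G[of 0 n] by (simp add: sums_iff)
  have p_le: "p n (Suc k) \<le> 1 - p n 0" for n k
  proof -
    have "sum (\<lambda>k. p n (Suc k)) {k} \<le> (\<Sum>k. p n (Suc k))"
      using p_tail[of n] nonneg by (intro sum_le_suminf) (auto simp: sums_iff)
    then show ?thesis
      using p_tail[of n] by (simp add: sums_iff)
  qed
  have G_ge: "G n z \<ge> p n 0" if "0 \<le> z" "z < 1" for n z
  proof -
    have "0 \<le> G n z - p n 0"
      using sums_le[OF _ sums_zero G_tail[OF that]] nonneg that(1) by auto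
    then show ?thesis by simp
  qed
  have G_le: "G n z \<le> p n 0 + z" if "0 \<le> z" "z < 1" for n z
  proof -
    have "z ^ Suc k \<le> z" for k
      using that power_le_one[of z k] by (simp add: mult_left_le)
    then have "p n (Suc k) * z ^ Suc k \<le> p n (Suc k) * z" for k
      using nonneg by (intro mult_left_mono)
    then have "G n z - p n 0 \<le> (1 - p n 0) * z"
      by (rule sums_le [OF _ G_tail[OF that] sums_mult2 [OF p_tail]])
    also have "\<dots> \<le> z"
      using nonneg[of n 0] that(1) by (simp add: algebra_simps)
    finally show ?thesis by simp
  qed
  \<comment> \<open>If \<open>p 1 0 = 0\<close>, then every one of the \<open>n\<close> summands is at least \<open>1\<close>, so \<open>p 1\<close> would have to
      sit above every \<open>n\<close>. In terms of generating functions, \<open>G 1 (1/2) \<le> (1/2)^n\<close> for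
      all \<open>n\<close>.\<close>
  have p0_pos: "p 1 0 > 0"
  proof (rule ccontr)
    assume "\<not> p 1 0 > 0"
    then have "p 1 0 = 0"
      using nonneg[of 1 0] by simp
    then have p0: "p n 0 = 0" if "n \<ge> 1" for n
      using root[OF that, of 0] that by (simp add: G_0)
    have bound: "G 1 (1 / 2) \<le> (1 / 2) ^ n" if "n \<ge> 1" for n
    proof -
      have "G n (1 / 2) ^ n \<le> (1 / 2) ^ n"
        using G_le[of "1 / 2" n] G_ge[of "1 / 2" n] p0[OF that] by (intro power_mono) auto
      then show ?thesis
        using root[OF that, of "1 / 2"] by simp
    qed
    have "(\<lambda>n. (1 / 2 :: real) ^ n) \<longlonglongrightarrow> 0"
      by (rule LIMSEQ_realpow_zero) auto
    then have "G 1 (1 / 2) \<le> 0"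
      by (rule LIMSEQ_le_const) (use bound in auto)
    with G_ge[of "1 / 2" 1] nonneg[of 1 0] have G_half: "G 1 (1 / 2) = 0"
      by linarith
    have "(\<lambda>k. p 1 k * (1 / 2) ^ k) sums 0"
      using G[of "1 / 2" 1] unfolding G_half by simp
    then have "\<forall>k. p 1 k * (1 / 2) ^ k = 0"
      using nonneg[of 1] suminf_eq_zero_iff[of "\<lambda>k. p 1 k * (1 / 2) ^ k"] by (auto simp: sums_iff)
    then have "p 1 = (\<lambda>_. 0)"
      by auto
    with total[of 1] show False
      by (simp add: sums_iff)
  qed
  have log_limit: "(\<lambda>n. real n * (G n z - 1)) \<longlonglongrightarrow> ln (G 1 z)" if "0 \<le> z" "z < 1" for z
  proof (rule nth_roots_log_limit)
    show "G n z \<ge> 0" if "n \<ge> 1" for n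
      using G_ge[OF \<open>0 \<le> z\<close> \<open>z < 1\<close>, of n] nonneg[of n 0] by linarith
    show "G n z ^ n = G 1 z" if "n \<ge> 1" for n
      using root[OF that \<open>0 \<le> z\<close> \<open>z < 1\<close>] .
    show "G 1 z > 0"
      using G_ge[OF that, of 1] p0_pos by linarith
  qed
  have log_p0: "(\<lambda>n. real n * (p n 0 - 1)) \<longlonglongrightarrow> ln (p 1 0)"
    using log_limit[of 0] by (simp add: G_0)
  \<comment> \<open>This single bound dominates all rates and feeds Tannery's theorem below.\<close>
  then obtain K where K: "\<And>n. \<bar>real n * (p n 0 - 1)\<bar> \<le> K"
    using convergent_imp_Bseq[unfolded Bseq_def] by (fastforce simp: convergent_def Bseq_def)
  have rate_le: "real n * p n (Suc k) \<le> K" for n k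
  proof -
    have "real n * p n (Suc k) \<le> real n * (1 - p n 0)"
      using p_le by (intro mult_left_mono) auto
    then show ?thesis
      using K[of n] by (simp add: algebra_simps)
  qed
  have tail_limit: "(\<lambda>n. \<Sum>k. real n * p n (Suc k) * z ^ Suc k) \<longlonglongrightarrow> (\<Sum>k. c (Suc k) * z ^ Suc k)"
  proof (rule tannerys_theorem [THEN conjunct2, THEN conjunct2])
    show "(\<lambda>n. real n * p n (Suc k) * z ^ Suc k) \<longlonglongrightarrow> c (Suc k) * z ^ Suc k" for k
      by (intro tendsto_mult_right rate) simp
    have "norm (real n * p n (Suc k) * z ^ Suc k) \<le> K * z ^ Suc k" for n k
    proof -
      have "norm (real n * p n (Suc k) * z ^ Suc k) = real n * p n (Suc k) * z ^ Suc k"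
        using nonneg z by simp
      also have "\<dots> \<le> K * z ^ Suc k"
        using rate_le z by (intro mult_right_mono) auto
      finally show ?thesis .
    qed
    then show "\<forall>\<^sub>F (k, n) in at_top \<times>\<^sub>F sequentially. norm (real n * p n (Suc k) * z ^ Suc k) \<le> K * z ^ Suc k"
      by (intro always_eventually) auto
    show "summable (\<lambda>k. K * z ^ Suc k)"
      using z by (intro summable_mult) (simp add: summable_mult summable_geometric)
  qed simp
  have "real n * (G n z - 1) = real n * (p n 0 - 1) + (\<Sum>k. real n * p n (Suc k) * z ^ Suc k)" for n
  proof -
    have "(\<lambda>k. real n * p n (Suc k) * z ^ Suc k) sums (real n * (G n z - p n 0))"
      using sums_mult[OF G_tail[OF z], of "real n" n] by (simp add: mult.assoc)
    then show ?thesis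
      by (simp add: sums_iff algebra_simps)
  qed
  then have "(\<lambda>n. real n * (G n z - 1)) \<longlonglongrightarrow> ln (p 1 0) + (\<Sum>k. c (Suc k) * z ^ Suc k)"
    using tendsto_add[OF log_p0 tail_limit] by simp
  with log_limit[OF z] have ln_G: "ln (G 1 z) = ln (p 1 0) + (\<Sum>k. c (Suc k) * z ^ Suc k)"
    by (rule LIMSEQ_unique)
  have "G 1 z > 0"
    using G_ge[OF z, of 1] p0_pos by linarith
  then have "G 1 z = exp (ln (G 1 z))"
    by simp
  also have "\<dots> = p 1 0 * exp (\<Sum>k. c (Suc k) * z ^ Suc k)"
    using p0_pos by (simp only: ln_G exp_add exp_ln)
  finally show ?thesis .
qed

section \<open>Probability generating functions\<close>

context prob_space
begin

lemma pgf_sums: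
  fixes Y :: "'a \<Rightarrow> nat" and z :: real
  assumes Y [measurable]: "random_variable (count_space UNIV) Y" and z: "0 \<le> z" "z \<le> 1"
  shows "(\<lambda>k. prob {\<omega> \<in> space M. Y \<omega> = k} * z ^ k) sums expectation (\<lambda>\<omega>. z ^ Y \<omega>)"
proof -
  define f where "f k \<omega> = z ^ k * indicator {\<omega> \<in> space M. Y \<omega> = k} \<omega>" for k \<omega>
  have f_int: "integral\<^sup>L M (f k) = prob {\<omega> \<in> space M. Y \<omega> = k} * z ^ k" for k
    unfolding f_def by simp
  have f_sums: "(\<lambda>k. f k \<omega>) sums (z ^ Y \<omega>)" if "\<omega> \<in> space M" for \<omega>
  proof -
    have "(\<lambda>k. f k \<omega>) sums (\<Sum>k\<in>{Y \<omega>}. f k \<omega>)"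
      by (rule sums_finite) (use that in \<open>auto simp: f_def\<close>)
    then show ?thesis
      using that by (simp add: f_def)
  qed
  have "(\<lambda>k. integral\<^sup>L M (f k)) sums (\<integral>\<omega>. (\<Sum>k. f k \<omega>) \<partial>M)"
  proof (rule sums_integral)
    show "integrable M (f k)" for k
      unfolding f_def by (intro integrable_real_mult_indicator integrable_mult_right) auto
    have norm_f: "norm (f k \<omega>) = f k \<omega>" for k \<omega>
      using z by (simp add: f_def)
    show "AE \<omega> in M. summable (\<lambda>k. norm (f k \<omega>))"
      unfolding norm_f by (intro AE_I2 sums_summable [OF f_sums])
    have "disjoint_family (\<lambda>k. {\<omega> \<in> space M. Y \<omega> = k})"
      by (auto simp: disjoint_family_on_def)
    moreover have "{\<omega> \<in> space M. Y \<omega> = k} \<in> events" for k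
      by measurable
    then have "range (\<lambda>k. {\<omega> \<in> space M. Y \<omega> = k}) \<subseteq> events"
      by (rule image_subsetI)
    ultimately have "summable (\<lambda>k. prob {\<omega> \<in> space M. Y \<omega> = k})"
      by (rule sums_summable [OF finite_measure_UNION, rotated])
    moreover have "norm (prob {\<omega> \<in> space M. Y \<omega> = k} * z ^ k) \<le> prob {\<omega> \<in> space M. Y \<omega> = k}" for k
      using z by (simp add: mult_left_le power_le_one)
    ultimately show "summable (\<lambda>k. \<integral>\<omega>. norm (f k \<omega>) \<partial>M)"
      unfolding norm_f f_int by (rule summable_comparison_test'[where N = 0])
  qed
  also have "(\<integral>\<omega>. (\<Sum>k. f k \<omega>) \<partial>M) = expectation (\<lambda>\<omega>. z ^ Y \<omega>)"
    by (rule Bochner_Integration.integral_cong) (use f_sums in \<open>auto simp: sums_iff\<close>)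
  finally show ?thesis
    by (simp add: f_int)
qed

section \<open>Counting processes with stationary independent increments\<close>

text \<open>As the process starts at \<open>0\<close>, the increment over \<open>[0, s]\<close> is \<open>N(s)\<close> itself.\<close>

lemma increment_same_law:
  assumes "stationary_increments N" "counting_process N" "\<forall>\<omega>\<in>space M. N 0 \<omega> = 0"
    and "t \<ge> 0" "s > 0"
  shows "distr M (count_space UNIV) (increment N t (t + s)) = distr M (count_space UNIV) (N s)"
proof -
  have "distr M (count_space UNIV) (increment N t (t + s)) =
      distr M (count_space UNIV) (increment N 0 (0 + s))"
    using assms unfolding stationary_increments_def by (meson order_refl)
  also have "\<dots> = distr M (count_space UNIV) (N s)"
    by (rule distr_cong) (use assms(3) in \<open>auto simp: increment_def\<close>)
  finally show ?thesis .
qed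

lemma increment_measurable:
  assumes "counting_process N" "0 \<le> s" "0 \<le> t"
  shows "increment N s t \<in> measurable M (count_space UNIV)"
proof -
  have [measurable]: "N s \<in> measurable M (count_space UNIV)" "N t \<in> measurable M (count_space UNIV)"
    using assms by (auto simp: counting_process_def)
  show ?thesis
    unfolding increment_def by measurable
qed

text \<open>\<open>N(t)\<close> is the telescoping sum of its increments over \<open>n\<close> intervals of length \<open>t/n\<close>;
  these are independent and distributed like \<open>N(t/n)\<close>.\<close>

lemma pgf_power:
  fixes z t :: real
  assumes N: "counting_process N" "\<forall>\<omega>\<in>space M. N 0 \<omega> = 0"
    and inc: "stationary_increments N" "independent_increments N"
    and z: "0 \<le> z" "z \<le> 1" and t: "t > 0" and n: "n \<ge> 1"
  shows "expectation (\<lambda>\<omega>. z ^ N (t / real n) \<omega>) ^ n = expectation (\<lambda>\<omega>. z ^ N t \<omega>)"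
proof -
  define \<tau> where "\<tau> i = real i * (t / real n)" for i :: nat
  define D where "D i = increment N (\<tau> i) (\<tau> (Suc i))" for i
  have step: "t / real n > 0"
    using t n by simp
  have \<tau>_nonneg: "\<tau> i \<ge> 0" for i
    using t by (simp add: \<tau>_def)
  have \<tau>_Suc: "\<tau> (Suc i) = \<tau> i + t / real n" for i
    by (simp add: \<tau>_def algebra_simps add_divide_distrib)
  have D_meas: "D i \<in> measurable M (count_space UNIV)" for i
    unfolding D_def using N(1) \<tau>_nonneg by (intro increment_measurable)
  have "\<forall>i<n. \<tau> i < \<tau> (Suc i)"
    using step by (simp add: \<tau>_Suc)
  then have "indep_vars (\<lambda>_. count_space UNIV) D {..<n}"
    using inc(2) \<tau>_nonneg unfolding independent_increments_def D_def by blast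
  then have indep: "indep_vars (\<lambda>_. borel) (\<lambda>i \<omega>. z ^ D i \<omega>) {..<n}"
    by (rule indep_vars_compose2) auto
  have integrable: "integrable M (\<lambda>\<omega>. z ^ D i \<omega>)" for i
  proof (rule integrable_const_bound[where B = 1])
    show "(\<lambda>\<omega>. z ^ D i \<omega>) \<in> borel_measurable M"
      using measurable_compose[OF D_meas[of i], of "\<lambda>k. z ^ k" borel] by simp
  qed (use z in \<open>auto simp: power_le_one\<close>)
  have telescope: "(\<Sum>i<m. D i \<omega>) = N (\<tau> m) \<omega>" if "\<omega> \<in> space M" for m \<omega>
  proof (induction m)
    case 0
    then show ?case
      using N(2) that by (simp add: \<tau>_def)
  next
    case (Suc m)
    have "N (\<tau> m) \<omega> \<le> N (\<tau> (Suc m)) \<omega>"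
      using N(1) that \<tau>_nonneg[of m] step unfolding counting_process_def by (simp add: \<tau>_Suc)
    with Suc show ?case
      by (simp add: D_def increment_def)
  qed
  have same: "expectation (\<lambda>\<omega>. z ^ D i \<omega>) = expectation (\<lambda>\<omega>. z ^ N (t / real n) \<omega>)" for i
  proof -
    have N_meas: "N (t / real n) \<in> measurable M (count_space UNIV)"
      using N(1) step by (simp add: counting_process_def)
    have "expectation (\<lambda>\<omega>. z ^ D i \<omega>) = (\<integral>k. z ^ k \<partial>distr M (count_space UNIV) (D i))"
      by (rule integral_distr [OF D_meas, symmetric]) simp
    also have "distr M (count_space UNIV) (D i) = distr M (count_space UNIV) (N (t / real n))"
      unfolding D_def \<tau>_Suc by (rule increment_same_law [OF inc(1) N \<tau>_nonneg step])
    also have "(\<integral>k. z ^ k \<partial>distr M (count_space UNIV) (N (t / real n))) =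
        expectation (\<lambda>\<omega>. z ^ N (t / real n) \<omega>)"
      by (rule integral_distr [OF N_meas]) simp
    finally show ?thesis .
  qed
  have "expectation (\<lambda>\<omega>. z ^ N t \<omega>) = expectation (\<lambda>\<omega>. \<Prod>i<n. z ^ D i \<omega>)"
  proof (rule Bochner_Integration.integral_cong [OF refl])
    fix \<omega> assume "\<omega> \<in> space M"
    then show "z ^ N t \<omega> = (\<Prod>i<n. z ^ D i \<omega>)"
      using telescope[of \<omega> n] n by (simp add: power_sum [symmetric] \<tau>_def)
  qed
  also have "\<dots> = (\<Prod>i<n. expectation (\<lambda>\<omega>. z ^ D i \<omega>))"
    using indep integrable by (intro indep_vars_lebesgue_integral) auto
  also have "\<dots> = expectation (\<lambda>\<omega>. z ^ N (t / real n) \<omega>) ^ n"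
    by (simp add: same)
  finally show ?thesis ..
qed

text \<open>This is the infinitesimal condition along \<open>s = t/n\<close>. It speaks of increments starting
  at a positive time, here \<open>1\<close>; stationarity transfers it to time \<open>0\<close>.\<close>

lemma bell_touchard_process_rate:
  assumes process: "bell_touchard_process \<alpha> \<theta> N" and k: "k \<ge> 1" and t: "t > 0"
  shows "(\<lambda>n. real n * prob {\<omega> \<in> space M. N (t / real n) \<omega> = k})
           \<longlonglongrightarrow> \<alpha> * t * \<theta> ^ k / fact k"
proof -
  define q where "q s = prob {\<omega> \<in> space M. N s \<omega> = k}" for s
  have N: "counting_process N" "\<forall>\<omega>\<in>space M. N 0 \<omega> = 0" "stationary_increments N"
    using process by (auto simp: bell_touchard_process_def)
  have law: "prob {\<omega> \<in> space M. increment N 1 (1 + s) \<omega> = k} = q s" if "s > 0" for s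
  proof -
    have "measure (distr M (count_space UNIV) (increment N 1 (1 + s))) {k} =
        measure (distr M (count_space UNIV) (N s)) {k}"
      using increment_same_law[OF N(3,1,2), of 1 s] that by simp
    moreover have "increment N 1 (1 + s) \<in> measurable M (count_space UNIV)"
      using N(1) that by (intro increment_measurable) auto
    moreover have "N s \<in> measurable M (count_space UNIV)"
      using N(1) that by (simp add: counting_process_def)
    ultimately show ?thesis
      by (simp add: measure_distr q_def vimage_def Int_def conj_commute)
  qed
  have "((\<lambda>s. (prob {\<omega> \<in> space M. increment N 1 (1 + s) \<omega> = k} - \<alpha> * s * \<theta> ^ k / fact k) / s)
      \<longlongrightarrow> 0) (at_right 0)"
    using process k by (simp add: bell_touchard_process_def)
  moreover have "\<forall>\<^sub>F s in at_right 0.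
      (prob {\<omega> \<in> space M. increment N 1 (1 + s) \<omega> = k} - \<alpha> * s * \<theta> ^ k / fact k) / s =
      q s / s - \<alpha> * \<theta> ^ k / fact k"
    using eventually_at_right_less[of 0]
    by eventually_elim (simp add: law diff_divide_distrib)
  ultimately have "((\<lambda>s. q s / s - \<alpha> * \<theta> ^ k / fact k) \<longlongrightarrow> 0) (at_right 0)"
    by (rule Lim_transform_eventually)
  then have lim: "((\<lambda>s. q s / s) \<longlongrightarrow> \<alpha> * \<theta> ^ k / fact k) (at_right 0)"
    by (simp add: LIM_zero_iff)
  have "filterlim (\<lambda>n. t / real n) (at_right 0) sequentially"
    using t by real_asymp
  from filterlim_compose[OF lim this]
  have "(\<lambda>n. t * (q (t / real n) / (t / real n))) \<longlonglongrightarrow> t * (\<alpha> * \<theta> ^ k / fact k)"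
    by (rule tendsto_mult_left)
  then show ?thesis
    using t by (simp add: q_def field_simps)
qed

section \<open>One-dimensional distributions of Bell-Touchard processes\<close>

text \<open>The law of \<open>N(t)\<close> is first identified up to the factor \<open>p 1 0 = Pr[N(t) = 0]\<close>, which the
  total mass \<open>1\<close> then determines. The Bell series converges at \<open>z = 1\<close> as well, so this needs
  no boundary limit of \<open>G\<close>.\<close>

lemma bell_touchard_process_marginal:
  assumes "\<alpha> > 0" "\<theta> > 0" and process: "bell_touchard_process \<alpha> \<theta> N" and t: "t > 0"
  shows "prob {\<omega> \<in> space M. N t \<omega> = k} = bell_touchard_mass (\<alpha> * t) \<theta> k"
proof -
  have N: "counting_process N" "\<forall>\<omega>\<in>space M. N 0 \<omega> = 0"
    and inc: "stationary_increments N" "independent_increments N"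
    using process by (auto simp: bell_touchard_process_def)
  have N_meas: "random_variable (count_space UNIV) (N s)" if "s \<ge> 0" for s
    using N(1) that by (simp add: counting_process_def)
  \<comment> \<open>For \<open>n = 0\<close> the time \<open>t / real n\<close> is \<open>0\<close>, so \<open>p 0\<close> is again a probability distribution.\<close>
  define p where "p n k = prob {\<omega> \<in> space M. N (t / real n) \<omega> = k}" for n k
  define G where "G n z = expectation (\<lambda>\<omega>. z ^ N (t / real n) \<omega>)" for n and z :: real
  define b where "b k = \<theta> ^ k / fact k * bell_poly k (\<alpha> * t)" for k
  have G_sums: "(\<lambda>k. p n k * z ^ k) sums G n z" if "0 \<le> z" "z \<le> 1" for n z
    unfolding p_def G_def using t that by (intro pgf_sums N_meas) auto
  have p_total: "p n sums 1" for n
    using G_sums[of 1 n] by (simp add: G_def prob_space)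
  have b_sums: "(\<lambda>k. b k * z ^ k) sums exp (\<alpha> * t * (exp (\<theta> * z) - 1))" if "0 \<le> z" for z
    unfolding b_def using assms that by (intro bell_poly_generating_function) auto
  have G_eq: "G 1 z = p 1 0 * exp (\<alpha> * t * (exp (\<theta> * z) - 1))" if z: "0 \<le> z" "z < 1" for z
  proof -
    have "G 1 z = p 1 0 * exp (\<Sum>k. \<alpha> * t * \<theta> ^ Suc k / fact (Suc k) * z ^ Suc k)"
    proof (rule generating_function_of_nth_roots)
      show "G n z ^ n = G 1 z" if "n \<ge> 1" "0 \<le> z" "z < 1" for n z
        unfolding G_def using pgf_power[OF N inc _ _ t that(1), of z] that by simp
      show "(\<lambda>n. real n * p n k) \<longlonglongrightarrow> \<alpha> * t * \<theta> ^ k / fact k" if "k \<ge> 1" for k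
        unfolding p_def by (rule bell_touchard_process_rate [OF process that t])
      show "(\<lambda>k. p n k * z ^ k) sums G n z" if "0 \<le> z" "z < 1" for n z
        using G_sums that by simp
    qed (use z p_total in \<open>auto simp: p_def [abs_def]\<close>)
    also have "(\<Sum>k. \<alpha> * t * \<theta> ^ Suc k / fact (Suc k) * z ^ Suc k) = \<alpha> * t * (exp (\<theta> * z) - 1)"
    proof -
      have "(\<lambda>k. (\<theta> * z) ^ Suc k / fact (Suc k)) sums (exp (\<theta> * z) - 1)"
        using exp_converges[of "\<theta> * z"]
        by (subst sums_Suc_iff) (simp add: scaleR_conv_of_real divide_inverse mult.commute)
      from sums_mult[OF this, of "\<alpha> * t"] show ?thesis
        by (simp add: sums_iff power_mult_distrib mult_ac)
    qed
    finally show ?thesis .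
  qed
  have p_eq: "p 1 = (\<lambda>k. p 1 0 * b k)"
  proof (rule powser_coeffs_unique)
    fix z :: real assume z: "0 \<le> z" "z < 1"
    show "(\<lambda>k. p 1 k * z ^ k) sums G 1 z"
      using z by (intro G_sums) auto
    show "(\<lambda>k. p 1 0 * b k * z ^ k) sums G 1 z"
      using sums_mult[OF b_sums[OF z(1)], of "p 1 0"] unfolding G_eq[OF z] by (simp add: mult.assoc)
  qed
  have "(\<lambda>k. p 1 0 * b k) sums (p 1 0 * exp (\<alpha> * t * (exp \<theta> - 1)))"
    using sums_mult[OF b_sums[of 1], of "p 1 0"] by simp
  with p_total[of 1] p_eq have "1 = p 1 0 * exp (\<alpha> * t * (exp \<theta> - 1))"
    using sums_unique2 by metis
  then have "p 1 0 = exp (- (\<alpha> * t) * (exp \<theta> - 1))"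
    by (simp add: exp_minus divide_simps mult.commute)
  then have "p 1 k = bell_touchard_mass (\<alpha> * t) \<theta> k"
    using fun_cong[OF p_eq, of k] by (simp add: b_def bell_touchard_mass_def)
  then show ?thesis
    by (simp add: p_def)
qed

end

theorem theorem3p1:
  fixes M :: "'a measure" and N :: "real \<Rightarrow> 'a \<Rightarrow> nat" and \<alpha> \<theta> :: real
  assumes "prob_space M"
    and "\<alpha> > 0" and "\<theta> > 0"
    and "prob_space.bell_touchard_process M \<alpha> \<theta> N"
  shows "\<forall>t\<ge>0. prob_space.bell_touchard_distributed M (N t) (\<alpha> * t) \<theta>"
proof (intro allI impI)
  interpret prob_space M by fact
  fix t :: real assume t: "t \<ge> 0"
  have process: "bell_touchard_process \<alpha> \<theta> N" by fact
  then have meas: "random_variable (count_space UNIV) (N t)"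
    and start: "\<And>\<omega>. \<omega> \<in> space M \<Longrightarrow> N 0 \<omega> = 0"
    using t by (auto simp: bell_touchard_process_def counting_process_def)
  have "prob {\<omega> \<in> space M. N t \<omega> = k} = bell_touchard_mass (\<alpha> * t) \<theta> k" for k
  proof (cases "t = 0")
    case True
    have "{\<omega> \<in> space M. N 0 \<omega> = k} = (if k = 0 then space M else {})"
      using start by auto
    then show ?thesis
      using True by (simp add: bell_touchard_mass_0 prob_space)
  next
    case False
    then show ?thesis
      using bell_touchard_process_marginal[OF assms(2,3) process] t by simp
  qed
  with meas show "bell_touchard_distributed (N t) (\<alpha> * t) \<theta>"
    by (simp add: bell_touchard_distributed_def)
qed

end
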